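(* Let $M\in\mathbb{R}^{m\times n}$ with $M\neq0$, and let $P_B,\widetilde P_B\in\mathbb{R}^{m\times m}$ and $P_A,\widetilde P_A\in\mathbb{R}^{n\times n}$ be symmetric positive definite (the "current" maps $P_B,P_A$ and the "cached" maps $\widetilde P_B,\widetilde P_A$). Let $q_P(D)=\|P_B^{-1}DP_A^{-1}\|_{\mathrm{op}}$ be the current weighted norm, and let $\widetilde D$ be any positive rescaling of an exact unit-radius oracle for the cached maps, i.e. $\widetilde D=cD^\star$ with $c>0$ and $D^\star$ a maximizer of $\langle M,D\rangle$ over $D\in\mathbb{R}^{m\times n}$ subject to $\|\widetilde P_B^{-1}D\widetilde P_A^{-1}\|_{\mathrm{op}}\le1$. Define $$\Theta=\kappa_2(P_B^{-1}\widetilde P_B)\,\kappa_2(P_A^{-1}\widetilde P_A).$$ Then $$\frac{\langle M,\widetilde D\rangle}{q_P(\widetilde D)\,\|P_BMP_A\|_*}\ \ge\ \Theta^{-1}.$$ Thus, after rescaling to its actual radius in the current ball, the cached direction achieves at least a $\Theta^{-1}$ fraction of the current optimum: $\langle M,\widetilde D\rangle\ge\Theta^{-1}\max\{\langle M,D\rangle: q_P(D)\le q_P(\widetilde D)\}$. The ratio on the left-hand side is unchanged by the Frobenius graft, i.e. when $\widetilde D$ is replaced by $\widetilde D\,\sqrt{\min(m,n)}/\|\widetilde D\|_F$.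
   Context: $\langle X,Y\rangle=\operatorname{tr}(X^\top Y)$ is the Frobenius inner product, $\|\cdot\|_{\mathrm{op}}$ the spectral norm, $\|\cdot\|_*$ the nuclear norm, $\|\cdot\|_F$ the Frobenius norm, and $\kappa_2(X)=\sigma_{\max}(X)/\sigma_{\min}(X)$ the spectral condition number (ratio of extreme singular values) of an invertible, not necessarily symmetric, matrix. *)

theory Defs
  imports "HOL-Analysis.Analysis"
begin

definition frob_inner :: "real^'n^'m \<Rightarrow> real^'n^'m \<Rightarrow> real"
  where "frob_inner X Y = trace (transpose X ** Y)"

definition frob_norm :: "real^'n^'m \<Rightarrow> real"
  where "frob_norm X = sqrt (frob_inner X X)"

definition spectral_norm :: "real^'n^'m \<Rightarrow> real"
  where "spectral_norm X = onorm (\<lambda>v. X *v v)"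

definition sym_pos_def :: "real^'n^'n \<Rightarrow> bool"
  where "sym_pos_def P \<longleftrightarrow> transpose P = P \<and> (\<forall>x. x \<noteq> 0 \<longrightarrow> 0 < x \<bullet> (P *v x))"

text \<open>The right singular space of \<open>X\<close> at level \<open>s\<close> is the eigenspace of \<open>X\<^sup>TX\<close> for
  the eigenvalue \<open>s\<^sup>2\<close>; its dimension is the multiplicity of the singular value \<open>s\<close>.
  For an \<open>m \<times> n\<close> matrix with \<open>n > m\<close> this convention counts additional zero singular values,
  which do not contribute to the nuclear norm; for square matrices it is the usual one.\<close>

definition sing_space :: "real^'n^'m \<Rightarrow> real \<Rightarrow> (real^'n) set"
  where "sing_space X s = {v. (transpose X ** X) *v v = s\<^sup>2 *\<^sub>R v}"

definition singular_values :: "real^'n^'m \<Rightarrow> real set"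
  where "singular_values X = {s. 0 \<le> s \<and> (\<exists>v \<in> sing_space X s. v \<noteq> 0)}"

definition nuclear_norm :: "real^'n^'m \<Rightarrow> real"
  where "nuclear_norm X = (\<Sum>s \<in> singular_values X. real (dim (sing_space X s)) * s)"

definition cond2 :: "real^'n^'n \<Rightarrow> real"
  where "cond2 X = Max (singular_values X) / Min (singular_values X)"

definition weighted_norm :: "real^'m^'m \<Rightarrow> real^'n^'n \<Rightarrow> real^'n^'m \<Rightarrow> real"
  where "weighted_norm PB PA D = spectral_norm (matrix_inv PB ** D ** matrix_inv PA)"

definition unit_oracle :: "real^'m^'m \<Rightarrow> real^'n^'n \<Rightarrow> real^'n^'m \<Rightarrow> real^'n^'m \<Rightarrow> bool"
  where "unit_oracle PB PA M D \<longleftrightarrow>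
    is_arg_max (frob_inner M) (\<lambda>D. weighted_norm PB PA D \<le> 1) D"

definition frob_graft :: "real^'n^'m \<Rightarrow> real^'n^'m"
  where "frob_graft D = (sqrt (real (min CARD('m) CARD('n))) / frob_norm D) *\<^sub>R D"

text \<open>\<open>Max\<close>, \<open>Min\<close> and the sum above range over a finite set:\<close>

lemma finite_singular_values:
  fixes X :: "real^'n^'m"
  shows "finite (singular_values X)"
proof -
  define v where "v s = (SOME v. v \<in> sing_space X s \<and> v \<noteq> 0)" for s
  have v: "v s \<in> sing_space X s" "v s \<noteq> 0" if "s \<in> singular_values X" for s
    using that someI_ex[of "\<lambda>v. v \<in> sing_space X s \<and> v \<noteq> 0"]
    unfolding v_def singular_values_def by blast+
  have orth: "v s \<bullet> v t = 0"
    if s: "s \<in> singular_values X" and t: "t \<in> singular_values X" and "s \<noteq> t" for s t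
  proof -
    let ?A = "transpose X ** X"
    have "s\<^sup>2 * (v s \<bullet> v t) = (?A *v v s) \<bullet> v t"
      using v(1)[OF s] by (simp add: sing_space_def)
    also have "\<dots> = v s \<bullet> (?A *v v t)"
      by (metis dot_lmul_matrix matrix_transpose_mul transpose_matrix_vector transpose_transpose)
    also have "\<dots> = t\<^sup>2 * (v s \<bullet> v t)"
      using v(1)[OF t] by (simp add: sing_space_def)
    finally have "s\<^sup>2 = t\<^sup>2 \<or> v s \<bullet> v t = 0" by auto
    moreover have "s\<^sup>2 \<noteq> t\<^sup>2"
      using s t \<open>s \<noteq> t\<close> by (simp add: singular_values_def)
    ultimately show ?thesis by simp
  qed
  have inj: "inj_on v (singular_values X)"
    by (rule inj_onI) (metis orth v(2) inner_eq_zero_iff)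
  have "pairwise orthogonal (v ` singular_values X)"
    unfolding pairwise_def orthogonal_def using orth by fastforce
  then have "independent (v ` singular_values X)"
    using v(2) by (intro pairwise_orthogonal_independent) auto
  then have "finite (v ` singular_values X)"
    by (rule independent_imp_finite)
  then show ?thesis using inj by (rule finite_imageD)
qed

end

theory Submission
  imports Defs
begin

text \<open>With \<open>R\<^sub>B = P\<^sub>B\<^sup>-\<^sup>1 Q\<^sub>B\<close> and \<open>R\<^sub>A = P\<^sub>A\<^sup>-\<^sup>1 Q\<^sub>A\<close>, where \<open>Q\<close> denotes the cached maps,
  \<open>P\<^sub>B\<^sup>-\<^sup>1 D P\<^sub>A\<^sup>-\<^sup>1 = R\<^sub>B (Q\<^sub>B\<^sup>-\<^sup>1 D Q\<^sub>A\<^sup>-\<^sup>1) R\<^sub>A\<^sup>T\<close>. Hence passing from the cached norm to the current one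
  and back costs at most the factor \<open>\<parallel>R\<^sub>B\<parallel> \<parallel>R\<^sub>B\<^sup>-\<^sup>1\<parallel> \<parallel>R\<^sub>A\<parallel> \<parallel>R\<^sub>A\<^sup>-\<^sup>1\<parallel> \<le> \<Theta>\<close>, so every competitor in the current
  ball lies in the cached ball enlarged by \<open>\<Theta>\<close>, over which the cached oracle is optimal. The current
  optimum is evaluated by the duality of the spectral and nuclear norms, which rests on an
  orthonormal eigenbasis of \<open>X\<^sup>TX\<close>.\<close>

section \<open>The Frobenius inner product and rank-one matrices\<close>

lemma frob_inner_eq_inner: "frob_inner X Y = X \<bullet> Y" for X Y :: "real^'n^'m"
proof -
  have "frob_inner X Y = (\<Sum>j\<in>UNIV. \<Sum>i\<in>UNIV. X $ i $ j * Y $ i $ j)"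
    by (simp add: frob_inner_def trace_def matrix_matrix_mult_def transpose_def)
  also have "\<dots> = X \<bullet> Y"
    by (subst sum.swap) (simp add: inner_vec_def)
  finally show ?thesis .
qed

lemma inner_transpose_matrix_vector: "(transpose A *v x) \<bullet> y = x \<bullet> (A *v y)"
  for A :: "real^'n^'m"
  by (simp add: dot_lmul_matrix)

lemma inner_gram: "x \<bullet> ((transpose X ** X) *v y) = (X *v x) \<bullet> (X *v y)"
  for X :: "real^'n^'m"
  by (metis inner_commute inner_transpose_matrix_vector matrix_vector_mul_assoc)

text \<open>Cyclicity of the trace carries the right factor to the front, so both factors pass to
  the other argument as transposes.\<close>

lemma frob_inner_mult_both:
  fixes M :: "real^'n^'m" and P :: "real^'m^'k" and Q :: "real^'l^'n"
  shows "frob_inner (P ** M ** Q) E = frob_inner M (transpose P ** E ** transpose Q)"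
proof -
  have "frob_inner (P ** M ** Q) E = trace (transpose Q ** (transpose M ** transpose P ** E))"
    by (simp add: frob_inner_def matrix_transpose_mul matrix_mul_assoc)
  also have "\<dots> = trace ((transpose M ** transpose P ** E) ** transpose Q)"
    by (rule trace_mul_sym)
  finally show ?thesis
    by (simp add: frob_inner_def matrix_mul_assoc)
qed

text \<open>The rank-one matrix \<open>u b^T\<close>, the form of the summands in a singular value
  decomposition.\<close>

definition outer :: "real^'m \<Rightarrow> real^'n \<Rightarrow> real^'n^'m"
  where "outer u b = (\<chi> i j. u $ i * b $ j)"

lemma outer_mult_vector: "outer u b *v v = (v \<bullet> b) *\<^sub>R u"
  by (simp add: outer_def matrix_vector_mult_def vec_eq_iff inner_vec_def sum_distrib_left
      sum_distrib_right mult_ac)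

lemma frob_inner_outer: "frob_inner X (outer u b) = (X *v b) \<bullet> u"
  by (simp add: frob_inner_eq_inner outer_def inner_vec_def matrix_vector_mult_def
      sum_distrib_left mult_ac)

lemma sum_matrix_vector_mult: "(\<Sum>i\<in>I. A i) *v v = (\<Sum>i\<in>I. A i *v v)"
  for A :: "'i \<Rightarrow> real^'n^'m"
  by (induction I rule: infinite_finite_induct) (auto simp: matrix_vector_mult_add_rdistrib)

section \<open>The spectral norm\<close>

lemma spectral_norm_ge_0: "0 \<le> spectral_norm X"
  unfolding spectral_norm_def by (rule onorm_pos_le) simp

lemma norm_le_spectral_norm: "norm (X *v v) \<le> spectral_norm X * norm v"
  unfolding spectral_norm_def by (rule onorm) simp

lemma spectral_norm_leI: "(\<And>v. norm (X *v v) \<le> b * norm v) \<Longrightarrow> spectral_norm X \<le> b"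
  unfolding spectral_norm_def by (rule onorm_le)

lemma spectral_norm_mult: "spectral_norm (X ** Y) \<le> spectral_norm X * spectral_norm Y"
proof (rule spectral_norm_leI)
  fix v
  have "norm (X *v (Y *v v)) \<le> spectral_norm X * (spectral_norm Y * norm v)"
    by (meson norm_le_spectral_norm mult_left_mono order_trans spectral_norm_ge_0)
  then show "norm (X ** Y *v v) \<le> spectral_norm X * spectral_norm Y * norm v"
    by (simp add: matrix_vector_mul_assoc)
qed

text \<open>Writing the squared length of \<open>transpose X *v v\<close> as a pairing of
  \<open>v\<close> with an image under \<open>X\<close> leaves one factor of that length to
  cancel.\<close>

lemma spectral_norm_transpose_le: "spectral_norm (transpose X) \<le> spectral_norm X"
proof (rule spectral_norm_leI)
  fix v
  let ?w = "transpose X *v v"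
  have "norm ?w * norm ?w = v \<bullet> (X *v ?w)"
    by (metis inner_transpose_matrix_vector norm_eq_sqrt_inner real_sqrt_mult_self abs_of_nonneg inner_ge_zero)
  also have "\<dots> \<le> norm v * (spectral_norm X * norm ?w)"
    by (meson norm_cauchy_schwarz norm_le_spectral_norm mult_left_mono norm_ge_zero order_trans)
  finally have "norm ?w * norm ?w \<le> (spectral_norm X * norm v) * norm ?w"
    by (simp add: mult_ac)
  then show "norm ?w \<le> spectral_norm X * norm v"
    by (cases "norm ?w = 0") (auto simp: spectral_norm_ge_0 simp del: transpose_matrix_vector)
qed

lemma spectral_norm_scaleR: "spectral_norm (k *\<^sub>R X) = \<bar>k\<bar> * spectral_norm X"
  using onorm_scaleR[OF matrix_vector_mul_bounded_linear, of k X]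
  by (simp add: spectral_norm_def scaleR_matrix_vector_assoc)

lemma spectral_norm_eq_0_iff: "spectral_norm X = 0 \<longleftrightarrow> X = 0"
proof
  assume "spectral_norm X = 0"
  then have "X *v v = 0" for v
    using norm_le_spectral_norm[of X v] by simp
  then show "X = 0"
    by (simp add: matrix_eq)
qed (simp add: spectral_norm_def onorm_zero)

section \<open>Singular bases\<close>

text \<open>An orthonormal basis of right singular vectors. The singular value of \<open>b\<close>
  is stored as \<open>norm (X *v b)\<close>, and multiplicities are counted by the elements of the
  set.\<close>

definition singular_basis :: "real^'n^'m \<Rightarrow> (real^'n) set \<Rightarrow> bool"
  where "singular_basis X B \<longleftrightarrow> finite B \<and> pairwise orthogonal B \<and> (\<forall>b\<in>B. norm b = 1)
    \<and> span B = UNIV \<and> (\<forall>b\<in>B. b \<in> sing_space X (norm (X *v b)))"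

lemma subspace_sing_space: "subspace (sing_space X s)"
  by (auto simp: subspace_def sing_space_def algebra_simps)

lemma norm_mult_sing_space:
  assumes "v \<in> sing_space X s" "0 \<le> s"
  shows "norm (X *v v) = s * norm v"
proof -
  have "(norm (X *v v))\<^sup>2 = (s * norm v)\<^sup>2"
    using assms(1) inner_gram[of v X v]
    by (simp add: sing_space_def power_mult_distrib power2_norm_eq_inner)
  with assms(2) show ?thesis
    by (simp add: power2_eq_iff_nonneg)
qed

text \<open>Eigenvectors of the symmetric matrix \<open>transpose X ** X\<close> for different
  eigenvalues; nonnegativity of the levels keeps their squares different.\<close>

lemma sing_space_orthogonal:
  assumes "v \<in> sing_space X s" "w \<in> sing_space X t" "0 \<le> s" "0 \<le> t" "s \<noteq> t"
  shows "v \<bullet> w = 0"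
proof -
  have "s\<^sup>2 * (v \<bullet> w) = t\<^sup>2 * (v \<bullet> w)"
    using assms(1,2) inner_gram[of v X w] inner_gram[of w X v]
    by (simp add: sing_space_def inner_commute)
  moreover have "s\<^sup>2 \<noteq> t\<^sup>2"
    using assms by simp
  ultimately show ?thesis by simp
qed

text \<open>A maximiser of \<open>norm (X *v x)\<close> over the unit sphere of the subspace is an eigenvector
  of \<open>X\<^sup>TX\<close>, as the first-order condition shows.\<close>

lemma sing_vector_in_invariant_subspace:
  fixes X :: "real^'n^'m"
  assumes V: "subspace V" and inv: "\<And>v. v \<in> V \<Longrightarrow> (transpose X ** X) *v v \<in> V"
    and z: "z \<in> V" "z \<noteq> 0"
  obtains x where "x \<in> V" "norm x = 1" "x \<in> sing_space X (norm (X *v x))"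
proof -
  let ?K = "sphere 0 1 \<inter> V"
  have "compact ?K"
    using closed_subspace[OF V] by (intro compact_Int_closed) auto
  moreover have "z /\<^sub>R norm z \<in> ?K"
    using z V by (simp add: subspace_scale)
  ultimately obtain x where x: "x \<in> ?K" and max: "\<And>y. y \<in> ?K \<Longrightarrow> norm (X *v y) \<le> norm (X *v x)"
    using continuous_attains_sup[of ?K "\<lambda>x. norm (X *v x)"]
      continuous_on_norm[OF matrix_vector_mult_linear_continuous_on[of ?K X]] by blast
  let ?l = "(norm (X *v x))\<^sup>2"
  have bound: "(X *v y) \<bullet> (X *v y) \<le> ?l * (y \<bullet> y)" if "y \<in> V" for y
  proof (cases "y = 0")
    case False
    then have "norm (X *v (y /\<^sub>R norm y)) \<le> norm (X *v x)"
      using max V that by (simp add: subspace_scale)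
    then have "norm (X *v y) \<le> norm (X *v x) * norm y"
      using False by (simp add: matrix_vector_mult_scaleR field_simps)
    then have "(norm (X *v y))\<^sup>2 \<le> (norm (X *v x) * norm y)\<^sup>2"
      by (intro power_mono) auto
    then show ?thesis
      by (simp add: power_mult_distrib dot_square_norm)
  qed auto
  \<comment> \<open>The residual of the eigenvalue equation at \<open>x\<close>; perturbing
    \<open>x\<close> along it will show that it vanishes.\<close>
  let ?y = "?l *\<^sub>R x - (transpose X ** X) *v x"
  have xV: "x \<in> V" and nx: "norm x = 1"
    using x by auto
  have yV: "?y \<in> V"
    using xV V inv by (intro subspace_diff subspace_scale) auto
  define g where "g = ?l * (?y \<bullet> ?y) - (X *v ?y) \<bullet> (X *v ?y)"
  \<comment> \<open>The gap in \<open>bound\<close> along the line \<open>x + t y\<close> is a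
    quadratic polynomial in \<open>t\<close>. For \<open>l = ?l\<close> its constant term is zero
    because \<open>x\<close> is a unit vector.\<close>
  have expand: "l * ((x + t *\<^sub>R y) \<bullet> (x + t *\<^sub>R y)) - (X *v (x + t *\<^sub>R y)) \<bullet> (X *v (x + t *\<^sub>R y))
      = (l * (x \<bullet> x) - (X *v x) \<bullet> (X *v x)) + 2 * t * (l * (y \<bullet> x) - (X *v y) \<bullet> (X *v x))
        + t\<^sup>2 * (l * (y \<bullet> y) - (X *v y) \<bullet> (X *v y))" for l t y
    by (simp add: matrix_vector_right_distrib matrix_vector_mult_scaleR inner_add_left
        inner_add_right inner_commute[of x y] inner_commute[of "X *v x" "X *v y"]
        power2_eq_square algebra_simps)
  have nonneg: "0 \<le> 2 * t * (?y \<bullet> ?y) + t\<^sup>2 * g" for t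
  proof -
    have "x + t *\<^sub>R ?y \<in> V"
      using xV yV V by (intro subspace_add subspace_scale)
    then have "0 \<le> ?l * ((x + t *\<^sub>R ?y) \<bullet> (x + t *\<^sub>R ?y))
        - (X *v (x + t *\<^sub>R ?y)) \<bullet> (X *v (x + t *\<^sub>R ?y))"
      using bound by simp
    moreover have "?l * (?y \<bullet> x) - (X *v ?y) \<bullet> (X *v x) = ?y \<bullet> ?y"
      by (simp only: inner_gram[symmetric] inner_diff_right[of ?y] inner_scaleR_right)
    moreover have "?l * (x \<bullet> x) - (X *v x) \<bullet> (X *v x) = 0"
      using nx by (simp add: dot_square_norm)
    ultimately show ?thesis
      unfolding expand g_def by simp
  qed
  have "?y \<bullet> ?y = 0"
  proof (rule ccontr)
    assume "?y \<bullet> ?y \<noteq> 0"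
    then have pos: "0 < ?y \<bullet> ?y"
      by (simp add: inner_gt_zero_iff)
    \<comment> \<open>Negative, and so small that the quadratic term cannot outweigh the linear one:
      \<open>t * g\<close> is at least \<open>- (?y \<bullet> ?y)\<close>. The \<open>+ 1\<close>
      keeps the denominator positive.\<close>
    define t where "t = - (?y \<bullet> ?y) / (\<bar>g\<bar> + 1)"
    have t: "t < 0" "- t * (\<bar>g\<bar> + 1) = ?y \<bullet> ?y"
      using pos by (simp_all add: t_def divide_neg_pos)
    have "t * (2 * (?y \<bullet> ?y) + t * g) \<ge> 0"
      using nonneg[of t] by (simp add: power2_eq_square algebra_simps)
    then have "2 * (?y \<bullet> ?y) + t * g \<le> 0"
      using t(1) by (simp add: zero_le_mult_iff)
    moreover have "t * g \<ge> t * (\<bar>g\<bar> + 1)"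
      using t(1) by (intro mult_left_mono_neg) auto
    ultimately show False
      using t pos by linarith
  qed
  then have "x \<in> sing_space X (norm (X *v x))"
    by (simp add: sing_space_def)
  with xV nx show ?thesis
    using that by blast
qed

text \<open>The orthogonal complement of all singular spaces is invariant under the symmetric matrix
  \<open>transpose X ** X\<close>. If it were nonzero, it would contain a singular vector, which
  would then be orthogonal to itself.\<close>

lemma span_sing_spaces: "span (\<Union>s\<in>singular_values X. sing_space X s) = UNIV"
proof (rule ccontr)
  let ?U = "\<Union>s\<in>singular_values X. sing_space X s"
  assume "span ?U \<noteq> UNIV"
  then obtain z where z: "z \<noteq> 0" "\<And>x. x \<in> ?U \<Longrightarrow> z \<bullet> x = 0"
    using span_not_UNIV_orthogonal by (metis span_base)
  define V where "V = {v. \<forall>u\<in>?U. v \<bullet> u = 0}"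
  have "subspace V"
    by (auto simp: subspace_def V_def inner_add_left)
  moreover have "(transpose X ** X) *v v \<in> V" if "v \<in> V" for v
  proof -
    have "((transpose X ** X) *v v) \<bullet> u = 0" if "s \<in> singular_values X" "u \<in> sing_space X s" for s u
    proof -
      have "((transpose X ** X) *v v) \<bullet> u = v \<bullet> ((transpose X ** X) *v u)"
        by (metis inner_gram inner_commute)
      also have "\<dots> = s\<^sup>2 * (v \<bullet> u)"
        using that by (simp add: sing_space_def)
      finally show ?thesis
        using \<open>v \<in> V\<close> that by (auto simp: V_def)
    qed
    then show ?thesis
      by (auto simp: V_def)
  qed
  moreover have "z \<in> V"
    using z by (auto simp: V_def)
  ultimately obtain x where x: "x \<in> V" "norm x = 1" "x \<in> sing_space X (norm (X *v x))"
    using sing_vector_in_invariant_subspace z(1) by blast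
  then have "norm (X *v x) \<in> singular_values X"
    by (auto simp: singular_values_def intro!: bexI[of _ x])
  with x have "x \<bullet> x = 0"
    by (auto simp: V_def)
  with x(2) show False
    by auto
qed

text \<open>The union of orthonormal bases of the singular spaces works. Grouping the last sum by
  singular value recovers the dimensions in the definition of the nuclear norm.\<close>

lemma singular_basis_exists:
  fixes X :: "real^'n^'m"
  obtains B where "singular_basis X B" "singular_values X = (\<lambda>b. norm (X *v b)) ` B"
    "nuclear_norm X = (\<Sum>b\<in>B. norm (X *v b))"
proof -
  have "\<exists>C. C \<subseteq> sing_space X s \<and> pairwise orthogonal C \<and> (\<forall>x\<in>C. norm x = 1) \<and> finite C
      \<and> card C = dim (sing_space X s) \<and> span C = sing_space X s" for s
    using orthonormal_basis_subspace[OF subspace_sing_space[of X s]]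
    by (metis independent_imp_finite)
  then obtain C where C: "\<And>s. C s \<subseteq> sing_space X s" "\<And>s. pairwise orthogonal (C s)"
      "\<And>s x. x \<in> C s \<Longrightarrow> norm x = 1" "\<And>s. finite (C s)" "\<And>s. card (C s) = dim (sing_space X s)"
      "\<And>s. span (C s) = sing_space X s"
    by metis
  let ?S = "singular_values X"
  define B where "B = (\<Union>s\<in>?S. C s)"
  have nonneg: "0 \<le> s" if "s \<in> ?S" for s
    using that by (simp add: singular_values_def)
  have sv: "norm (X *v b) = s" if "s \<in> ?S" "b \<in> C s" for s b
    using norm_mult_sing_space[of b X s] C(1,3) nonneg that by auto
  \<comment> \<open>The level can be read off a basis vector as \<open>norm (X *v b)\<close>, so
    bases at different levels share no vector.\<close>
  have disj: "C s \<inter> C t = {}" if "s \<in> ?S" "t \<in> ?S" "s \<noteq> t" for s t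
    using sv that by blast
  have "finite B"
    unfolding B_def using finite_singular_values C(4) by blast
  moreover have "pairwise orthogonal B"
    unfolding pairwise_def
  proof (intro ballI impI)
    fix x y assume "x \<in> B" "y \<in> B" "x \<noteq> y"
    then obtain s t where st: "s \<in> ?S" "t \<in> ?S" "x \<in> C s" "y \<in> C t"
      by (auto simp: B_def)
    show "orthogonal x y"
    proof (cases "s = t")
      case True
      then show ?thesis
        using C(2)[of s] st \<open>x \<noteq> y\<close> by (auto simp: pairwise_def)
    next
      case False
      then show ?thesis
        using sing_space_orthogonal[of x X s y t] st C(1) nonneg by (auto simp: orthogonal_def)
    qed
  qed
  moreover have "span B = UNIV"
  proof -
    have "sing_space X s \<subseteq> span B" if "s \<in> ?S" for s
      using span_mono[of "C s" B] C(6) that by (auto simp: B_def)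
    then have "span (\<Union>s\<in>?S. sing_space X s) \<subseteq> span B"
      by (intro span_minimal) auto
    then show ?thesis
      using span_sing_spaces[of X] by auto
  qed
  moreover have "\<forall>b\<in>B. norm b = 1 \<and> b \<in> sing_space X (norm (X *v b))"
    using C(1,3) sv unfolding B_def by fastforce
  ultimately have "singular_basis X B"
    by (simp add: singular_basis_def)
  moreover have "?S = (\<lambda>b. norm (X *v b)) ` B"
  proof -
    \<comment> \<open>A singular value has a nonzero singular vector, so the basis of its space is
      nonempty.\<close>
    have "C s \<noteq> {}" if "s \<in> ?S" for s
      using that C(6)[of s] by (auto simp: singular_values_def)
    then have "?S \<subseteq> (\<lambda>b. norm (X *v b)) ` B"
      using sv unfolding B_def by (force simp: image_iff)
    moreover have "(\<lambda>b. norm (X *v b)) ` B \<subseteq> ?S"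
      using sv by (auto simp: B_def)
    ultimately show ?thesis by blast
  qed
  moreover have "nuclear_norm X = (\<Sum>b\<in>B. norm (X *v b))"
  proof -
    have "(\<Sum>b\<in>B. norm (X *v b)) = (\<Sum>s\<in>?S. \<Sum>b\<in>C s. norm (X *v b))"
      unfolding B_def using finite_singular_values C(4) disj by (intro sum.UNION_disjoint) auto
    also have "\<dots> = (\<Sum>s\<in>?S. \<Sum>b\<in>C s. s)"
      using sv by simp
    also have "\<dots> = nuclear_norm X"
      using C(5) by (simp add: nuclear_norm_def)
    finally show ?thesis ..
  qed
  ultimately show ?thesis
    using that by blast
qed

context
  fixes X :: "real^'n^'m" and B
  assumes basis: "singular_basis X B"
begin

lemma singular_basis_finite: "finite B"
  and singular_basis_norm: "b \<in> B \<Longrightarrow> norm b = 1"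
  and singular_basis_eigen: "b \<in> B \<Longrightarrow> (transpose X ** X) *v b = (norm (X *v b))\<^sup>2 *\<^sub>R b"
  using basis by (auto simp: singular_basis_def sing_space_def)

lemma singular_basis_expand: "(\<Sum>b\<in>B. (v \<bullet> b) *\<^sub>R b) = v"
  using basis by (intro orthonormal_basis_expand) (auto simp: singular_basis_def)

lemma singular_basis_parseval: "(\<Sum>b\<in>B. (v \<bullet> b)\<^sup>2) = (norm v)\<^sup>2"
proof -
  have "(norm v)\<^sup>2 = v \<bullet> (\<Sum>b\<in>B. (v \<bullet> b) *\<^sub>R b)"
    by (simp only: singular_basis_expand power2_norm_eq_inner)
  then show ?thesis
    by (simp add: inner_sum_right power2_eq_square)
qed

lemma singular_basis_image_orthogonal:
  assumes "b \<in> B" "d \<in> B" "b \<noteq> d"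
  shows "(X *v b) \<bullet> (X *v d) = 0"
proof -
  have "b \<bullet> d = 0"
    using assms basis by (auto simp: singular_basis_def pairwise_def orthogonal_def)
  then show ?thesis
    using assms singular_basis_eigen by (simp flip: inner_gram)
qed

text \<open>Apply \<open>Y\<close> to the orthonormal expansion of a vector. For
  \<open>Y = X\<close> this is the singular value decomposition, the singular value being the length
  of the left factor.\<close>

lemma matrix_eq_sum_outer: "Y = (\<Sum>b\<in>B. outer (Y *v b) b)" for Y :: "real^'n^'k"
proof -
  have "Y *v v = (\<Sum>b\<in>B. outer (Y *v b) b) *v v" for v
  proof -
    have "Y *v v = Y *v (\<Sum>b\<in>B. (v \<bullet> b) *\<^sub>R b)"
      by (simp only: singular_basis_expand)
    also have "\<dots> = (\<Sum>b\<in>B. outer (Y *v b) b *v v)"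
      by (simp add: outer_mult_vector linear_sum[OF matrix_vector_mul_linear] matrix_vector_mult_scaleR)
    finally show ?thesis
      by (simp add: sum_matrix_vector_mult)
  qed
  then show ?thesis
    unfolding matrix_eq by blast
qed

text \<open>The basis diagonalises \<open>transpose X ** X\<close>, so the quadratic form has no
  mixed terms. Bounds on the singular values thus become bounds on
  \<open>norm (X *v v)\<close>.\<close>

lemma norm_mult_vector_singular_basis:
  "(norm (X *v v))\<^sup>2 = (\<Sum>b\<in>B. (norm (X *v b))\<^sup>2 * (v \<bullet> b)\<^sup>2)"
proof -
  have "(norm (X *v v))\<^sup>2 = v \<bullet> ((transpose X ** X) *v (\<Sum>b\<in>B. (v \<bullet> b) *\<^sub>R b))"
    by (simp only: singular_basis_expand inner_gram power2_norm_eq_inner)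
  also have "\<dots> = v \<bullet> (\<Sum>b\<in>B. (v \<bullet> b) *\<^sub>R ((norm (X *v b))\<^sup>2 *\<^sub>R b))"
    using singular_basis_eigen
    by (simp only: linear_sum[OF matrix_vector_mul_linear] matrix_vector_mult_scaleR cong: sum.cong)
  also have "\<dots> = (\<Sum>b\<in>B. (norm (X *v b))\<^sup>2 * (v \<bullet> b)\<^sup>2)"
    by (simp add: inner_sum_right power2_eq_square mult_ac)
  finally show ?thesis .
qed

end

section \<open>Duality of the spectral and nuclear norms\<close>

text \<open>One half of the duality: with \<open>X\<close> expanded in its singular basis,
  Cauchy-Schwarz bounds each term by \<open>spectral_norm E\<close> times a singular value.\<close>

lemma frob_inner_le_nuclear_norm: "frob_inner X E \<le> spectral_norm E * nuclear_norm X"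
proof -
  obtain B where B: "singular_basis X B" and nuc: "nuclear_norm X = (\<Sum>b\<in>B. norm (X *v b))"
    using singular_basis_exists[of X] by metis
  have "frob_inner E X = frob_inner E (\<Sum>b\<in>B. outer (X *v b) b)"
    using matrix_eq_sum_outer[OF B, of X] by simp
  also have "\<dots> = (\<Sum>b\<in>B. frob_inner E (outer (X *v b) b))"
    by (simp add: frob_inner_eq_inner inner_sum_right)
  also have "\<dots> = (\<Sum>b\<in>B. (E *v b) \<bullet> (X *v b))"
    by (simp add: frob_inner_outer)
  also have "\<dots> \<le> (\<Sum>b\<in>B. spectral_norm E * norm (X *v b))"
  proof (rule sum_mono)
    fix b assume "b \<in> B"
    then have "norm (E *v b) \<le> spectral_norm E"
      using norm_le_spectral_norm[of E b] singular_basis_norm[OF B] by simp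
    then show "(E *v b) \<bullet> (X *v b) \<le> spectral_norm E * norm (X *v b)"
      by (meson norm_cauchy_schwarz mult_right_mono norm_ge_zero order_trans)
  qed
  finally show ?thesis
    by (simp add: nuc sum_distrib_left frob_inner_eq_inner inner_commute)
qed

text \<open>The other half of the duality. The witness is the partial isometry in the polar
  decomposition of \<open>X\<close>.\<close>

lemma nuclear_norm_attained:
  fixes X :: "real^'n^'m"
  obtains E where "spectral_norm E \<le> 1" "frob_inner X E = nuclear_norm X"
proof -
  obtain B where B: "singular_basis X B" and nuc: "nuclear_norm X = (\<Sum>b\<in>B. norm (X *v b))"
    using singular_basis_exists[of X] by metis
  \<comment> \<open>\<open>sgn (X *v b)\<close> is the left singular vector, or \<open>0\<close> if the singular value vanishes.\<close>
  define E where "E = (\<Sum>b\<in>B. outer (sgn (X *v b)) b)"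
  have "frob_inner X E = (\<Sum>b\<in>B. (X *v b) \<bullet> sgn (X *v b))"
    by (simp add: E_def frob_inner_eq_inner inner_sum_right flip: frob_inner_outer)
  also have "\<dots> = nuclear_norm X"
    unfolding nuc by (intro sum.cong refl) (simp add: sgn_div_norm dot_square_norm power2_eq_square field_simps)
  finally have "frob_inner X E = nuclear_norm X" .
  moreover have "spectral_norm E \<le> 1"
  proof (rule spectral_norm_leI)
    fix v
    have orth: "sgn (X *v b) \<bullet> sgn (X *v d) = 0" if "b \<in> B" "d \<in> B" "b \<noteq> d" for b d
      using singular_basis_image_orthogonal[OF B that] by (simp add: sgn_div_norm)
    have "(norm (E *v v))\<^sup>2 = (norm (\<Sum>b\<in>B. (v \<bullet> b) *\<^sub>R sgn (X *v b)))\<^sup>2"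
      by (simp add: E_def sum_matrix_vector_mult outer_mult_vector)
    also have "\<dots> = (\<Sum>b\<in>B. (norm ((v \<bullet> b) *\<^sub>R sgn (X *v b)))\<^sup>2)"
      by (rule norm_sum_Pythagorean[OF singular_basis_finite[OF B]])
        (simp add: pairwise_def orthogonal_def orth)
    \<comment> \<open>Only an inequality, since \<open>sgn\<close> has norm 0 where the singular
      value vanishes.\<close>
    also have "\<dots> \<le> (\<Sum>b\<in>B. (v \<bullet> b)\<^sup>2)"
      by (intro sum_mono) (simp add: norm_sgn)
    also have "\<dots> = (norm v)\<^sup>2"
      by (rule singular_basis_parseval[OF B])
    finally show "norm (E *v v) \<le> 1 * norm v"
      by simp
  qed
  ultimately show ?thesis
    using that by blast
qed

lemma nuclear_norm_pos:
  assumes "X \<noteq> 0"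
  shows "0 < nuclear_norm X"
proof -
  have "0 < frob_inner X X"
    using assms by (simp add: frob_inner_eq_inner)
  also have "\<dots> \<le> spectral_norm X * nuclear_norm X"
    by (rule frob_inner_le_nuclear_norm)
  finally show ?thesis
    using spectral_norm_ge_0[of X] by (simp add: zero_less_mult_iff)
qed

section \<open>Condition numbers\<close>

text \<open>With \<open>lo\<close> and \<open>hi\<close> the extreme singular values,
  \<open>R\<close> stretches lengths by factors between \<open>lo\<close> and \<open>hi\<close>, and
  its inverse \<open>S\<close> therefore by at most \<open>1 / lo\<close>.\<close>

lemma spectral_norm_mult_inverse_le_cond2:
  fixes R S :: "real^'n^'n"
  assumes SR: "S ** R = mat 1"
  shows "spectral_norm R * spectral_norm S \<le> cond2 R" and "0 < cond2 R"
proof -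
  obtain B where B: "singular_basis R B" and sv: "singular_values R = (\<lambda>b. norm (R *v b)) ` B"
    using singular_basis_exists[of R] by metis
  define hi lo where "hi = Max (singular_values R)" and "lo = Min (singular_values R)"
  have fin: "finite (singular_values R)"
    by (rule finite_singular_values)
  \<comment> \<open>An empty basis would expand even a coordinate vector to zero. Nonemptiness makes
    \<open>Max\<close> and \<open>Min\<close> meaningful.\<close>
  have "B \<noteq> {}"
  proof
    assume "B = {}"
    then have "axis undefined 1 = (0 :: real^'n)"
      using singular_basis_expand[OF B, of "axis undefined 1"] by simp
    then show False
      by simp
  qed
  then have ne: "singular_values R \<noteq> {}"
    using sv by simp
  have between: "lo \<le> norm (R *v b)" "norm (R *v b) \<le> hi" if "b \<in> B" for b
    using that fin sv by (auto simp: lo_def hi_def)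
  have inj: "v = 0" if "R *v v = 0" for v
    using that SR by (metis matrix_vector_mul_assoc matrix_vector_mul_lid matrix_vector_mult_0_right)
  have "0 < s" if "s \<in> singular_values R" for s
    using that inj sv singular_basis_norm[OF B] by fastforce
  then have "0 < lo"
    using Min_in[OF fin ne] by (simp add: lo_def)
  moreover have "lo \<le> hi"
    using between \<open>B \<noteq> {}\<close> by force
  ultimately show "0 < cond2 R"
    by (simp add: cond2_def flip: hi_def lo_def)
  have upper: "norm (R *v v) \<le> hi * norm v" for v
  proof -
    have "(norm (R *v v))\<^sup>2 \<le> (\<Sum>b\<in>B. hi\<^sup>2 * (v \<bullet> b)\<^sup>2)"
      unfolding norm_mult_vector_singular_basis[OF B, of v]
      using between by (intro sum_mono mult_right_mono power_mono) auto
    also have "\<dots> = (hi * norm v)\<^sup>2"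
      using singular_basis_parseval[OF B, of v] by (simp add: power_mult_distrib flip: sum_distrib_left)
    finally show ?thesis
      using \<open>0 < lo\<close> \<open>lo \<le> hi\<close> by (simp add: power2_le_iff_abs_le)
  qed
  have lower: "lo * norm v \<le> norm (R *v v)" for v
  proof -
    have "(lo * norm v)\<^sup>2 = (\<Sum>b\<in>B. lo\<^sup>2 * (v \<bullet> b)\<^sup>2)"
      using singular_basis_parseval[OF B, of v] by (simp add: power_mult_distrib flip: sum_distrib_left)
    also have "\<dots> \<le> (norm (R *v v))\<^sup>2"
      unfolding norm_mult_vector_singular_basis[OF B, of v]
      using between \<open>0 < lo\<close> by (intro sum_mono mult_right_mono power_mono) auto
    finally show ?thesis
      by (rule power2_le_imp_le) simp
  qed
  have "spectral_norm S \<le> 1 / lo"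
  proof (rule spectral_norm_leI)
    fix w
    \<comment> \<open>A left inverse of a square matrix is a right inverse, so the lower bound at
      \<open>S *v w\<close> has \<open>norm w\<close> on its right-hand side.\<close>
    have "R ** S = mat 1"
      using SR by (simp add: matrix_left_right_inverse)
    then have "lo * norm (S *v w) \<le> norm w"
      using lower[of "S *v w"] by (simp add: matrix_vector_mul_assoc)
    then show "norm (S *v w) \<le> 1 / lo * norm w"
      using \<open>0 < lo\<close> by (simp add: field_simps)
  qed
  moreover have "spectral_norm R \<le> hi"
    using upper by (rule spectral_norm_leI)
  ultimately have "spectral_norm R * spectral_norm S \<le> hi * (1 / lo)"
    using \<open>0 < lo\<close> \<open>lo \<le> hi\<close> by (intro mult_mono) (auto simp: spectral_norm_ge_0)
  then show "spectral_norm R * spectral_norm S \<le> cond2 R"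
    by (simp add: cond2_def hi_def lo_def)
qed

text \<open>Positive definiteness forces a trivial kernel, hence invertibility. The transposed
  inverse is again an inverse of \<open>P\<close>, so uniqueness makes it symmetric.\<close>

lemma sym_pos_def_inverse:
  assumes "sym_pos_def P"
  shows "matrix_inv P ** P = mat 1" "P ** matrix_inv P = mat 1"
    "transpose P = P" "transpose (matrix_inv P) = matrix_inv P"
proof -
  have "\<forall>x. P *v x = 0 \<longrightarrow> x = 0"
    using assms by (force simp: sym_pos_def_def)
  then have "invertible P"
    by (metis invertible_left_inverse matrix_left_invertible_ker)
  then have inv: "P ** matrix_inv P = mat 1 \<and> matrix_inv P ** P = mat 1"
    unfolding matrix_inv_def invertible_def by (rule someI_ex)
  then show "matrix_inv P ** P = mat 1" "P ** matrix_inv P = mat 1"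
    by auto
  show "transpose P = P"
    using assms by (simp add: sym_pos_def_def)
  then have "transpose (matrix_inv P) ** P = mat 1"
    using inv by (metis matrix_transpose_mul transpose_mat)
  then show "transpose (matrix_inv P) = matrix_inv P"
    using inv by (metis matrix_mul_assoc matrix_mul_lid matrix_mul_rid)
qed

lemma cond2_change_of_map:
  assumes P: "sym_pos_def P" and Q: "sym_pos_def Q"
  shows "spectral_norm (matrix_inv P ** Q) * spectral_norm (matrix_inv Q ** P) \<le> cond2 (matrix_inv P ** Q)"
    and "0 < cond2 (matrix_inv P ** Q)"
proof -
  have "(matrix_inv Q ** P) ** (matrix_inv P ** Q) = matrix_inv Q ** (P ** matrix_inv P) ** Q"
    by (simp add: matrix_mul_assoc)
  also have "\<dots> = mat 1"
    by (simp add: sym_pos_def_inverse[OF P] sym_pos_def_inverse[OF Q])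
  finally have "(matrix_inv Q ** P) ** (matrix_inv P ** Q) = mat 1" .
  from spectral_norm_mult_inverse_le_cond2[OF this]
  show "spectral_norm (matrix_inv P ** Q) * spectral_norm (matrix_inv Q ** P) \<le> cond2 (matrix_inv P ** Q)"
    "0 < cond2 (matrix_inv P ** Q)" .
qed

section \<open>Weighted norms\<close>

lemma weighted_norm_ge_0: "0 \<le> weighted_norm PB PA D"
  by (simp add: weighted_norm_def spectral_norm_ge_0)

lemma weighted_norm_scaleR: "weighted_norm PB PA (k *\<^sub>R D) = \<bar>k\<bar> * weighted_norm PB PA D"
  by (simp add: weighted_norm_def spectral_norm_scaleR matrix_scalar_ac flip: scalar_matrix_assoc)

context
  fixes PB PBt :: "real^'m^'m" and PA PAt :: "real^'n^'n"
  assumes PB: "sym_pos_def PB" and PA: "sym_pos_def PA"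
begin

text \<open>The substitution \<open>D = PB ** E ** PA\<close> turns the weighted ball into the
  spectral ball of the same radius.\<close>

lemma weighted_norm_mult_both: "weighted_norm PB PA (PB ** E ** PA) = spectral_norm E"
proof -
  have "matrix_inv PB ** (PB ** E ** PA) ** matrix_inv PA
      = (matrix_inv PB ** PB) ** E ** (PA ** matrix_inv PA)"
    by (simp add: matrix_mul_assoc)
  then show ?thesis
    by (simp add: weighted_norm_def sym_pos_def_inverse[OF PB] sym_pos_def_inverse[OF PA])
qed

lemma eq_mult_both: "PB ** (matrix_inv PB ** D ** matrix_inv PA) ** PA = D"
proof -
  have "PB ** (matrix_inv PB ** D ** matrix_inv PA) ** PA
      = (PB ** matrix_inv PB) ** D ** (matrix_inv PA ** PA)"
    by (simp add: matrix_mul_assoc)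
  then show ?thesis
    by (simp add: sym_pos_def_inverse[OF PB] sym_pos_def_inverse[OF PA])
qed

lemma weighted_norm_eq_0_iff: "weighted_norm PB PA D = 0 \<longleftrightarrow> D = 0"
proof -
  have "matrix_inv PB ** D ** matrix_inv PA = 0 \<longleftrightarrow> D = 0"
    using eq_mult_both[of D] by auto
  then show ?thesis
    by (simp add: weighted_norm_def spectral_norm_eq_0_iff)
qed

lemma frob_inner_congruence: "frob_inner M (PB ** E ** PA) = frob_inner (PB ** M ** PA) E"
  by (simp add: frob_inner_mult_both sym_pos_def_inverse[OF PB] sym_pos_def_inverse[OF PA])

lemma frob_inner_le_weighted_norm:
  "frob_inner M D \<le> weighted_norm PB PA D * nuclear_norm (PB ** M ** PA)"
proof -
  let ?E = "matrix_inv PB ** D ** matrix_inv PA"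
  have "frob_inner M D = frob_inner (PB ** M ** PA) ?E"
    by (metis eq_mult_both frob_inner_congruence)
  then show ?thesis
    using frob_inner_le_nuclear_norm by (simp add: weighted_norm_def)
qed

text \<open>Submultiplicativity applied to the factorisation through the other pair of maps. The
  right factor appears transposed because \<open>PA\<close> and \<open>PAt\<close> are symmetric and
  multiply from the right.\<close>

lemma weighted_norm_change_of_map:
  assumes PBt: "sym_pos_def PBt" and PAt: "sym_pos_def PAt"
  shows "weighted_norm PB PA D \<le> spectral_norm (matrix_inv PB ** PBt)
    * spectral_norm (matrix_inv PA ** PAt) * weighted_norm PBt PAt D"
proof -
  let ?RB = "matrix_inv PB ** PBt" and ?RA = "matrix_inv PA ** PAt"
  let ?E = "matrix_inv PBt ** D ** matrix_inv PAt"
  have "transpose ?RA = PAt ** matrix_inv PA"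
    by (simp add: matrix_transpose_mul sym_pos_def_inverse[OF PA] sym_pos_def_inverse[OF PAt])
  then have "?RB ** ?E ** transpose ?RA
      = matrix_inv PB ** (PBt ** matrix_inv PBt) ** D ** (matrix_inv PAt ** PAt) ** matrix_inv PA"
    by (simp add: matrix_mul_assoc)
  then have "weighted_norm PB PA D = spectral_norm (?RB ** ?E ** transpose ?RA)"
    by (simp add: weighted_norm_def sym_pos_def_inverse[OF PBt] sym_pos_def_inverse[OF PAt])
  also have "\<dots> \<le> spectral_norm ?RB * spectral_norm ?E * spectral_norm (transpose ?RA)"
    by (meson spectral_norm_mult mult_right_mono order_trans spectral_norm_ge_0)
  also have "\<dots> \<le> spectral_norm ?RB * spectral_norm ?E * spectral_norm ?RA"
    by (intro mult_left_mono spectral_norm_transpose_le mult_nonneg_nonneg spectral_norm_ge_0)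
  finally show ?thesis
    by (simp add: weighted_norm_def mult_ac)
qed

end

section \<open>The cached oracle against the current optimum\<close>

text \<open>By homogeneity: a nonzero \<open>E\<close> divided by its weighted norm is feasible for
  the oracle problem.\<close>

lemma frob_inner_unit_oracle:
  assumes PB: "sym_pos_def PB" and PA: "sym_pos_def PA" and D: "unit_oracle PB PA M D"
  shows "frob_inner M E \<le> weighted_norm PB PA E * frob_inner M D"
proof (cases "E = 0")
  case False
  let ?w = "weighted_norm PB PA E"
  have pos: "0 < ?w"
    using False weighted_norm_eq_0_iff[OF PB PA, of E] weighted_norm_ge_0[of PB PA E] by linarith
  then have "weighted_norm PB PA (E /\<^sub>R ?w) \<le> 1"
    by (simp add: weighted_norm_scaleR)
  then have "frob_inner M (E /\<^sub>R ?w) \<le> frob_inner M D"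
    using D by (force simp: unit_oracle_def is_arg_max_def not_less)
  then show ?thesis
    using pos by (simp add: frob_inner_eq_inner field_simps)
qed (simp add: frob_inner_eq_inner weighted_norm_eq_0_iff[OF PB PA, THEN iffD2])

theorem proposition7:
  fixes M Dstar Dt :: "real^'n^'m"
    and PB PBt :: "real^'m^'m"
    and PA PAt :: "real^'n^'n"
    and c \<Theta> :: real
  assumes "M \<noteq> 0"
    and "sym_pos_def PB" and "sym_pos_def PBt"
    and "sym_pos_def PA" and "sym_pos_def PAt"
    and "unit_oracle PBt PAt M Dstar"
    and "c > 0" and "Dt = c *\<^sub>R Dstar"
    and "\<Theta> = cond2 (matrix_inv PB ** PBt) * cond2 (matrix_inv PA ** PAt)"
  shows "frob_inner M Dt / (weighted_norm PB PA Dt * nuclear_norm (PB ** M ** PA)) \<ge> inverse \<Theta>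
    \<and> (\<exists>Dopt. is_arg_max (frob_inner M) (\<lambda>D. weighted_norm PB PA D \<le> weighted_norm PB PA Dt) Dopt
           \<and> frob_inner M Dt \<ge> inverse \<Theta> * frob_inner M Dopt)
    \<and> frob_inner M (frob_graft Dt)
          / (weighted_norm PB PA (frob_graft Dt) * nuclear_norm (PB ** M ** PA))
        = frob_inner M Dt / (weighted_norm PB PA Dt * nuclear_norm (PB ** M ** PA))"
proof -
  note PB = assms(2) and PBt = assms(3) and PA = assms(4) and PAt = assms(5)
  define X where "X = PB ** M ** PA"
  define w where "w = weighted_norm PB PA Dt"
  define f where "f = frob_inner M Dt"
  have f_eq: "f = c * frob_inner M Dstar"
    by (simp add: f_def assms(8) frob_inner_eq_inner)
  have X: "X \<noteq> 0"
  proof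
    assume "X = 0"
    \<comment> \<open>The second argument is \<open>M\<close> itself, written as a congruence so
      that the pairing moves onto \<open>X\<close>.\<close>
    then have "frob_inner M (PB ** (matrix_inv PB ** M ** matrix_inv PA) ** PA) = 0"
      unfolding frob_inner_congruence[OF PB PA] by (simp add: X_def frob_inner_eq_inner)
    then have "frob_inner M M = 0"
      by (simp only: eq_mult_both[OF PB PA])
    with assms(1) show False
      by (simp add: frob_inner_eq_inner)
  qed
  \<comment> \<open>Taking \<open>M\<close> as a competitor shows that the oracle value is positive,
    which gives \<open>Dt \<noteq> 0\<close> and a positive denominator.\<close>
  have "0 < frob_inner M M"
    using assms(1) by (simp add: frob_inner_eq_inner)
  also have "\<dots> \<le> weighted_norm PBt PAt M * frob_inner M Dstar"
    by (rule frob_inner_unit_oracle[OF PBt PAt assms(6)])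
  finally have "0 < frob_inner M Dstar"
    using weighted_norm_ge_0[of PBt PAt M] by (simp add: zero_less_mult_iff)
  then have f: "0 < f"
    using assms(7) by (simp add: f_eq)
  then have Dt: "Dt \<noteq> 0"
    by (auto simp: f_def frob_inner_eq_inner)
  then have w: "0 < w"
    unfolding w_def using weighted_norm_eq_0_iff[OF PB PA, of Dt] weighted_norm_ge_0[of PB PA Dt]
    by linarith
  let ?RB = "matrix_inv PB ** PBt" and ?RA = "matrix_inv PA ** PAt"
  let ?SB = "matrix_inv PBt ** PB" and ?SA = "matrix_inv PAt ** PA"
  note cond = cond2_change_of_map[OF PB PBt] cond2_change_of_map[OF PA PAt]
  have \<Theta>: "0 < \<Theta>"
    using cond by (simp add: assms(9))
  \<comment> \<open>The current radius \<open>w\<close> is bounded through the cached radius of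
    \<open>Dt\<close>, and the cached norm of \<open>D\<close> through \<open>w\<close>. The two
    changes of maps together cost at most \<Theta>.\<close>
  have competitor: "frob_inner M D \<le> \<Theta> * f" if D: "weighted_norm PB PA D \<le> w" for D
  proof -
    have "weighted_norm PBt PAt Dt \<le> c"
      using assms(6,7) by (simp add: assms(8) weighted_norm_scaleR unit_oracle_def is_arg_max_def)
    then have "w \<le> spectral_norm ?RB * spectral_norm ?RA * c"
      unfolding w_def
      by (intro order_trans[OF weighted_norm_change_of_map[OF PB PA PBt PAt]] mult_left_mono
          mult_nonneg_nonneg spectral_norm_ge_0)
    with D have "weighted_norm PB PA D \<le> spectral_norm ?RB * spectral_norm ?RA * c"
      by simp
    then have "weighted_norm PBt PAt D
        \<le> spectral_norm ?SB * spectral_norm ?SA * (spectral_norm ?RB * spectral_norm ?RA * c)"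
      by (intro order_trans[OF weighted_norm_change_of_map[OF PBt PAt PB PA]] mult_left_mono
          mult_nonneg_nonneg spectral_norm_ge_0)
    \<comment> \<open>Each change-of-map matrix is paired with its inverse, so that each pair is
      bounded by one condition number.\<close>
    also have "\<dots> = (spectral_norm ?RB * spectral_norm ?SB) * (spectral_norm ?RA * spectral_norm ?SA) * c"
      by (simp add: mult_ac)
    also have "\<dots> \<le> \<Theta> * c"
      unfolding assms(9) using cond assms(7)
      by (intro mult_right_mono mult_mono mult_nonneg_nonneg spectral_norm_ge_0) auto
    finally have "weighted_norm PBt PAt D * frob_inner M Dstar \<le> \<Theta> * c * frob_inner M Dstar"
      using \<open>0 < frob_inner M Dstar\<close> by (intro mult_right_mono) auto
    then show ?thesis
      using frob_inner_unit_oracle[OF PBt PAt assms(6), of D] by (simp add: f_eq)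
  qed
  obtain E where E: "spectral_norm E \<le> 1" "frob_inner X E = nuclear_norm X"
    by (rule nuclear_norm_attained)
  \<comment> \<open>The dual matrix \<open>E\<close> of \<open>X\<close>, carried back to the
    current ball and scaled to radius \<open>w\<close>.\<close>
  define Dopt where "Dopt = w *\<^sub>R (PB ** E ** PA)"
  have Dopt_norm: "weighted_norm PB PA Dopt \<le> w"
    using w E(1) by (simp add: Dopt_def weighted_norm_scaleR weighted_norm_mult_both[OF PB PA])
  have Dopt_value: "frob_inner M Dopt = w * nuclear_norm X"
    using frob_inner_congruence[OF PB PA, of M E] E(2)
    by (simp add: Dopt_def X_def frob_inner_eq_inner)
  have "frob_inner M D \<le> frob_inner M Dopt" if "weighted_norm PB PA D \<le> w" for D
  proof -
    have "frob_inner M D \<le> weighted_norm PB PA D * nuclear_norm X"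
      unfolding X_def by (rule frob_inner_le_weighted_norm[OF PB PA])
    also have "\<dots> \<le> w * nuclear_norm X"
      using that nuclear_norm_pos[OF X] by (intro mult_right_mono) auto
    finally show ?thesis
      by (simp add: Dopt_value)
  qed
  then have opt: "is_arg_max (frob_inner M) (\<lambda>D. weighted_norm PB PA D \<le> w) Dopt"
    using Dopt_norm by (auto simp: is_arg_max_def not_less)
  have le: "inverse \<Theta> * frob_inner M Dopt \<le> f"
    using competitor[OF Dopt_norm] \<Theta> by (simp add: field_simps)
  \<comment> \<open>The optimum equals \<open>w * nuclear_norm X\<close>, so this is the preceding
    inequality divided by a positive number.\<close>
  then have ratio: "inverse \<Theta> \<le> f / (w * nuclear_norm X)"
    using w nuclear_norm_pos[OF X] by (simp add: Dopt_value pos_le_divide_eq)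
  \<comment> \<open>The graft is a positive scaling by \<open>k\<close>, which cancels because
    numerator and denominator both have degree one in the direction.\<close>
  define k where "k = sqrt (real (min CARD('m) CARD('n))) / frob_norm Dt"
  have k: "0 < k"
    using Dt by (simp add: k_def frob_norm_def frob_inner_eq_inner)
  have "frob_graft Dt = k *\<^sub>R Dt"
    by (simp add: frob_graft_def k_def)
  then have "frob_inner M (frob_graft Dt) / (weighted_norm PB PA (frob_graft Dt) * nuclear_norm X)
      = f / (w * nuclear_norm X)"
    using k by (simp add: weighted_norm_scaleR frob_inner_eq_inner f_def w_def)
  with opt le ratio show ?thesis
    unfolding f_def w_def X_def by blast
qed

end
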